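(* Let $A\in\mathbb{R}^{m\times n}$ have rows $a_1,\dots,a_m$ with $\|a_i\|_{\ell^2}=1$ for all $i$, let $x\in\mathbb{R}^n$, and set $b_t=Ax$. Let $\beta\ge 0$ and $q\in(0,1)$ satisfy $\beta<q<1-\beta$, and suppose that $$\frac{q}{q-\beta}\left(\frac{2\sqrt{\beta}}{\sqrt{1-q-\beta}}+\frac{\beta}{1-q-\beta}\right)<\frac{\sigma_{q-\beta,\min}(A)^2}{\sigma_{\max}(A)^2}.$$ Define $$c_{A,\beta,q}=(q-\beta)\frac{\sigma_{q-\beta,\min}(A)^2}{q^2m}-\frac{\sigma_{\max}(A)^2}{qm}\left(\frac{2\sqrt{\beta}}{\sqrt{1-q-\beta}}+\frac{\beta}{1-q-\beta}\right).$$ Then $c_{A,\beta,q}>0$, and for every $b\in\mathbb{R}^m$ with $\|b-b_t\|_{\ell^0}\le\beta m$ and every starting point $x_0\in\mathbb{R}^n$, the iterates $x_k$ of the $q$-quantile Random Kaczmarz method applied to $(A,b)$ converge to $x$, in the sense that for all $k\ge 0$ $$\mathbb{E}\,\|x_k-x\|^2\le(1-c_{A,\beta,q})^k\,\|x_0-x\|^2.$$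
   Context: $\|\cdot\|$ is the Euclidean norm, and $\|v\|_{\ell^0}$ is the number of nonzero entries of $v$. The numbers $qm$ and $\beta m$ are taken to be integers. $\sigma_{\max}(A)$ is the largest singular value of $A$, and $$\sigma_{q-\beta,\min}(A)=\min_{S\subset\{1,\dots,m\},\ |S|=(q-\beta)m}\ \inf_{y\in\mathbb{R}^n,\ y\ne0}\frac{\|A_Sy\|}{\|y\|},$$ where $A_S$ is the submatrix of $A$ consisting of the rows indexed by $S$. The $q$-quantile Random Kaczmarz method: given $x_k$, let $Q$ be the $q$-quantile of the $m$ numbers $|\langle x_k,a_i\rangle-b_i|$, $1\le i\le m$ (the $(qm)$-th smallest of these numbers, counted with multiplicity), and let $$N_2=\{1\le i\le m:\ |\langle x_k,a_i\rangle-b_i|\le Q\}.$$ Choose $i\in N_2$ uniformly at random (independently of previous choices given $x_k$) and set $$x_{k+1}=x_k+(b_i-\langle a_i,x_k\rangle)a_i.$$ The expectation is over all random choices of the algorithm. *)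

theory Defs
  imports "HOL-Probability.Probability"
begin

definition l0_norm :: "real ^ 'm \<Rightarrow> nat" where
  "l0_norm v = card {i. v $ i \<noteq> 0}"

text \<open>
  The condition with unit singular vectors on both sides gives exactly the usual (at most
  \<open>min m n\<close>) singular values, also for rectangular matrices.
\<close>
definition singular_value :: "real ^ 'n ^ 'm \<Rightarrow> real \<Rightarrow> bool" where
  "singular_value A s \<longleftrightarrow> 0 \<le> s \<and>
     (\<exists>u v. norm u = 1 \<and> norm v = 1 \<and> A *v v = s *\<^sub>R u \<and> transpose A *v u = s *\<^sub>R v)"

definition sigma_max :: "real ^ 'n ^ 'm \<Rightarrow> real" where
  "sigma_max A = Max {s. singular_value A s}"

text \<open>
  The number of rows of the submatrix depends on \<open>S\<close>, so it is not a matrix of a fixed type;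
  the Euclidean norm of \<open>A\<^sub>S y\<close> is the \<open>L2_set\<close> norm over \<open>S\<close> of the entries of \<open>A y\<close>.
\<close>
definition norm_sub_rows :: "real ^ 'n ^ 'm \<Rightarrow> 'm set \<Rightarrow> real ^ 'n \<Rightarrow> real" where
  "norm_sub_rows A S y = L2_set (\<lambda>i. (A *v y) $ i) S"

definition sigma_sub_min :: "real \<Rightarrow> real ^ 'n ^ 'm \<Rightarrow> real" where
  "sigma_sub_min \<alpha> A =
     (MIN S\<in>{S :: 'm set. real (card S) = \<alpha> * real CARD('m)}.
        INF y\<in>{y. y \<noteq> 0}. norm_sub_rows A S y / norm y)"

definition residual :: "real ^ 'n ^ 'm \<Rightarrow> real ^ 'm \<Rightarrow> real ^ 'n \<Rightarrow> 'm \<Rightarrow> real" where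
  "residual A b y i = \<bar>y \<bullet> row i A - b $ i\<bar>"

text \<open>
  The \<open>(q m)\<close>-th smallest of the \<open>m\<close> values of \<open>f\<close>, counted with multiplicity; it is meant for
  \<open>q m\<close> an integer between \<open>1\<close> and \<open>m\<close>. List indices start at 0.
\<close>
definition quantile :: "real \<Rightarrow> ('m::finite \<Rightarrow> real) \<Rightarrow> real" where
  "quantile q f =
     sorted_list_of_multiset (image_mset f (mset_set UNIV)) ! (nat \<lfloor>q * real CARD('m)\<rfloor> - 1)"

definition admissible_rows :: "real \<Rightarrow> real ^ 'n ^ 'm \<Rightarrow> real ^ 'm \<Rightarrow> real ^ 'n \<Rightarrow> 'm set" where
  "admissible_rows q A b y = {i. residual A b y i \<le> quantile q (residual A b y)}"

definition kaczmarz_step :: "real ^ 'n ^ 'm \<Rightarrow> real ^ 'm \<Rightarrow> real ^ 'n \<Rightarrow> 'm \<Rightarrow> real ^ 'n" where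
  "kaczmarz_step A b y i = y + (b $ i - row i A \<bullet> y) *\<^sub>R row i A"

text \<open>The distribution of the \<open>k\<close>-th iterate \<open>x\<^sub>k\<close>.\<close>
primrec quantile_kaczmarz ::
  "real \<Rightarrow> real ^ 'n ^ 'm \<Rightarrow> real ^ 'm \<Rightarrow> real ^ 'n \<Rightarrow> nat \<Rightarrow> (real ^ 'n) pmf" where
  "quantile_kaczmarz q A b x0 0 = return_pmf x0"
| "quantile_kaczmarz q A b x0 (Suc k) =
     bind_pmf (quantile_kaczmarz q A b x0 k)
       (\<lambda>y. map_pmf (kaczmarz_step A b y) (pmf_of_set (admissible_rows q A b y)))"

definition corruption_factor :: "real \<Rightarrow> real \<Rightarrow> real" where
  "corruption_factor \<beta> q = 2 * sqrt \<beta> / sqrt (1 - q - \<beta>) + \<beta> / (1 - q - \<beta>)"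

definition rate :: "real ^ 'n ^ 'm \<Rightarrow> real \<Rightarrow> real \<Rightarrow> real" where
  "rate A \<beta> q =
     (q - \<beta>) * ((sigma_sub_min (q - \<beta>) A)\<^sup>2 / (q\<^sup>2 * real CARD('m)))
       - (sigma_max A)\<^sup>2 / (q * real CARD('m)) * corruption_factor \<beta> q"

end

theory Submission
  imports Defs
begin

text \<open>
  Write \<open>e = y - x\<close> for the current error, \<open>r\<^sub>i = row i A \<bullet> e\<close>, \<open>C\<close> for the set of corrupted
  equations, \<open>Q\<close> for the quantile and \<open>N\<close> for the set of admissible rows, \<open>s = card N\<close>. A step with
  row \<open>i\<close> changes \<open>\<parallel>e\<parallel>\<^sup>2\<close> by exactly \<open>- r\<^sub>i\<^sup>2\<close> if \<open>i\<close> is uncorrupted (a projection), and increases it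
  by at most \<open>2 Q \<bar>r\<^sub>i\<bar> + Q\<^sup>2\<close> if \<open>i\<close> is admissible and corrupted (a move of length at most \<open>Q\<close> along a
  unit vector). The proof compares the average gain with the average loss.

  \<^item> Loss. At least \<open>(1 - q) m\<close> residuals are at least \<open>Q\<close>, and at least \<open>(1 - q - \<beta>) m\<close> of these
    are uncorrupted, so are values \<open>\<bar>r\<^sub>i\<bar>\<close>; as \<open>\<Sum> r\<^sub>i\<^sup>2 = \<parallel>A e\<parallel>\<^sup>2 \<le> \<sigma>\<^sub>m\<^sub>a\<^sub>x\<^sup>2 \<parallel>e\<parallel>\<^sup>2\<close>, the quantile is
    small even though the corruption may be large. With Cauchy-Schwarz over the at most \<open>\<beta> m\<close>
    corrupted rows the total loss is at most \<open>\<sigma>\<^sub>m\<^sub>a\<^sub>x\<^sup>2 \<parallel>e\<parallel>\<^sup>2\<close> times the corruption factor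
    (\<open>corrupted_loss_bound\<close>), and the average divides it by \<open>s \<ge> q m\<close>.

  \<^item> Gain. The set \<open>N - C\<close> has at least \<open>s - \<beta> m\<close> elements. Residuals may coincide with \<open>Q\<close>, so \<open>s\<close>
    can exceed \<open>q m\<close>, and dividing a bound for one submatrix of \<open>(q - \<beta>) m\<close> rows by \<open>s\<close> would lose
    too much. Some subset of \<open>N - C\<close> of that size has an average of \<open>r\<^sub>i\<^sup>2\<close> below the average over
    \<open>N - C\<close> (\<open>exists_subset_below_average\<close>); this gives an average gain of at least
    \<open>\<sigma>\<^sub>m\<^sub>i\<^sub>n\<^sup>2 \<parallel>e\<parallel>\<^sup>2 / (q m)\<close> for every \<open>s \<ge> q m\<close>, since \<open>1 - \<beta> m / s\<close> grows with \<open>s\<close>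
    (\<open>average_gain_bound\<close>).

  Together these contract the conditional expectation of \<open>\<parallel>e\<parallel>\<^sup>2\<close> by \<open>1 - rate\<close> in each step
  (\<open>one_step_contraction\<close>), and the theorem follows by induction on the number of steps. The
  induction multiplies inequalities by \<open>1 - rate\<close>; this factor is nonnegative because the one-step
  bound, applied to any error \<open>e \<noteq> 0\<close>, bounds an expectation of squares by \<open>(1 - rate) \<parallel>e\<parallel>\<^sup>2\<close>.
\<close>

section \<open>Subsets with small average\<close>

lemma exists_subset_below_average:
  fixes f :: "'a \<Rightarrow> real"
  assumes "finite G" and "k \<le> card G"
  shows "\<exists>S\<subseteq>G. card S = k \<and> real (card G) * sum f S \<le> real k * sum f G"
  using assms
proof (induction "card G - k" arbitrary: G)
  case 0
  then show ?case by (intro exI[of _ G]) auto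
next
  case (Suc d)
  have ne: "G \<noteq> {}" and cG: "card G > 0" using Suc by auto
  \<comment> \<open>Discarding a largest value does not raise the average.\<close>
  obtain z where z: "z \<in> G" "\<And>i. i \<in> G \<Longrightarrow> f i \<le> f z"
    using Max_in[of "f ` G"] Max_ge[of "f ` G"] Suc.prems ne
    by (metis (no_types, lifting) finite_imageI image_iff image_is_empty)
  define H where "H = G - {z}"
  have cH: "card H = card G - 1" using z Suc.prems by (simp add: H_def)
  have "d = card H - k" "finite H" "k \<le> card H" using Suc cH by (auto simp: H_def)
  from Suc.hyps(1)[OF this] obtain S where S: "S \<subseteq> H" "card S = k"
    "real (card H) * sum f S \<le> real k * sum f H" by blast
  have sumG: "sum f G = f z + sum f H"
    unfolding H_def using z Suc.prems by (simp add: sum.remove)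
  have "sum f S \<le> (\<Sum>i\<in>S. f z)"
    by (intro sum_mono z) (use S in \<open>auto simp: H_def\<close>)
  then have "sum f S \<le> real k * f z" using S by simp
  moreover have "real (card G) = real (card H) + 1" using cH cG by simp
  ultimately have "real (card G) * sum f S \<le> real k * sum f G"
    using S(3) by (simp add: sumG algebra_simps)
  then show ?case using S by (intro exI[of _ S]) (auto simp: H_def)
qed

section \<open>Counting the values on either side of the quantile\<close>

lemma card_eq_card_positions:
  fixes f :: "'m::finite \<Rightarrow> real"
  defines "L \<equiv> sorted_list_of_multiset (image_mset f (mset_set UNIV))"
  shows "card {i. P (f i)} = card {j. j < length L \<and> P (L ! j)}"
proof -
  have "card {i. P (f i)} = size (filter_mset P (image_mset f (mset_set UNIV)))"
    by (simp add: filter_mset_image_mset)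
  also have "\<dots> = length (filter P L)"
    by (simp add: L_def flip: size_mset)
  finally show ?thesis by (simp add: length_filter_conv_card)
qed

lemma length_sorted_values:
  fixes f :: "'m::finite \<Rightarrow> real"
  shows "length (sorted_list_of_multiset (image_mset f (mset_set UNIV))) = CARD('m)"
  by (simp flip: size_mset)

lemma quantile_counts:
  fixes f :: "'m::finite \<Rightarrow> real"
  assumes "0 < q" "q < 1" "q * real CARD('m) \<in> \<int>"
  shows "q * real CARD('m) \<le> real (card {i. f i \<le> quantile q f})"
    and "(1 - q) * real CARD('m) \<le> real (card {i. quantile q f \<le> f i})"
proof -
  let ?L = "sorted_list_of_multiset (image_mset f (mset_set UNIV))"
  define p where "p = nat \<lfloor>q * real CARD('m)\<rfloor>"
  have m: "0 < CARD('m)" by simp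
  have rp: "real p = q * real CARD('m)"
    using assms m by (auto simp: p_def elim!: Ints_cases)
  have "0 < real p" using assms m by (simp add: rp)
  moreover have "real p < real CARD('m)" using assms m by (simp add: rp)
  ultimately have p: "0 < p" "p < CARD('m)" by simp_all
  have quant: "quantile q f = ?L ! (p - 1)" by (simp add: quantile_def p_def)
  have len: "length ?L = CARD('m)" by (rule length_sorted_values)
  have mono: "?L ! i \<le> ?L ! j" if "i \<le> j" "j < CARD('m)" for i j
    using that by (intro sorted_nth_mono) (simp_all add: len)
  have "{..<p} \<subseteq> {j. j < length ?L \<and> ?L ! j \<le> quantile q f}"
    using p by (auto simp: len quant intro!: mono)
  then have "card {..<p} \<le> card {i. f i \<le> quantile q f}"
    unfolding card_eq_card_positions[of "\<lambda>t. t \<le> quantile q f" f] by (intro card_mono) auto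
  then show "q * real CARD('m) \<le> real (card {i. f i \<le> quantile q f})"
    by (simp add: rp[symmetric])
  have "{p..<CARD('m)} \<subseteq> {j. j < length ?L \<and> quantile q f \<le> ?L ! j}"
    using p by (auto simp: len quant intro!: mono)
  then have "card {p..<CARD('m)} \<le> card {i. quantile q f \<le> f i}"
    unfolding card_eq_card_positions[of "\<lambda>t. quantile q f \<le> t" f] by (intro card_mono) auto
  then have "real (CARD('m) - p) \<le> real (card {i. quantile q f \<le> f i})" by simp
  then show "(1 - q) * real CARD('m) \<le> real (card {i. quantile q f \<le> f i})"
    using p by (simp add: of_nat_diff rp algebra_simps)
qed

section \<open>Singular value bounds\<close>

lemma matrix_vector_component_row:
  fixes A :: "real ^ 'n ^ 'm"
  shows "(A *v y) $ i = row i A \<bullet> y"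
  by (simp add: matrix_vector_mul_component row_def)

lemma norm_matrix_vector_square:
  fixes A :: "real ^ 'n ^ 'm"
  shows "(norm (A *v y))\<^sup>2 = (\<Sum>i\<in>UNIV. (row i A \<bullet> y)\<^sup>2)"
  by (simp add: norm_vec_def L2_set_def sum_nonneg matrix_vector_component_row)

lemma inner_transpose:
  fixes A :: "real ^ 'n ^ 'm"
  shows "(transpose A *v u) \<bullet> v = u \<bullet> (A *v v)"
  by (simp add: dot_lmul_matrix)

text \<open>
  Right singular vectors of distinct singular values are orthogonal, being eigenvectors of the
  symmetric matrix \<open>A\<^sup>T A\<close> for distinct eigenvalues.
\<close>
lemma finite_singular_values:
  fixes A :: "real ^ 'n ^ 'm"
  shows "finite {s. singular_value A s}"
proof -
  let ?S = "{s. singular_value A s}"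
  have "\<forall>s\<in>?S. \<exists>v. norm v = 1 \<and> transpose A *v (A *v v) = s\<^sup>2 *\<^sub>R v"
  proof
    fix s assume "s \<in> ?S"
    then obtain u v where uv: "norm v = 1" "A *v v = s *\<^sub>R u" "transpose A *v u = s *\<^sub>R v"
      by (auto simp: singular_value_def)
    have "transpose A *v (A *v v) = s\<^sup>2 *\<^sub>R v"
      by (simp only: uv matrix_vector_mult_scaleR) (simp add: power2_eq_square)
    with uv(1) show "\<exists>v. norm v = 1 \<and> transpose A *v (A *v v) = s\<^sup>2 *\<^sub>R v" by blast
  qed
  then obtain V where V: "\<And>s. s \<in> ?S \<Longrightarrow> norm (V s) = 1"
    "\<And>s. s \<in> ?S \<Longrightarrow> transpose A *v (A *v V s) = s\<^sup>2 *\<^sub>R V s" by metis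
  have orth: "V s \<bullet> V t = 0" if st: "s \<in> ?S" "t \<in> ?S" "s \<noteq> t" for s t
  proof -
    have "s\<^sup>2 * (V s \<bullet> V t) = (A *v V s) \<bullet> (A *v V t)"
      using V(2)[OF st(1)] inner_transpose[of A "A *v V s" "V t"] by simp
    also have "\<dots> = t\<^sup>2 * (V s \<bullet> V t)"
      using V(2)[OF st(2)] inner_transpose[of A "A *v V t" "V s"] by (simp add: inner_commute)
    finally show ?thesis
      using st by (auto simp: singular_value_def power2_eq_iff_nonneg)
  qed
  have inj: "inj_on V ?S"
    using orth V(1) by (intro inj_onI) (metis inner_eq_zero_iff norm_zero zero_neq_one)
  have "independent (V ` ?S)"
  proof (rule pairwise_orthogonal_independent)
    show "pairwise orthogonal (V ` ?S)"
      using orth by (auto simp: pairwise_def orthogonal_def)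
    show "0 \<notin> V ` ?S" using V(1) by (metis imageE norm_zero zero_neq_one)
  qed
  then have "finite (V ` ?S)" by (rule finiteI_independent)
  then show ?thesis using inj by (rule finite_imageD)
qed

text \<open>
  The operator norm \<open>M\<close> is attained at some unit vector \<open>v\<close> by compactness, and equality in
  Cauchy-Schwarz for \<open>(A\<^sup>T A v) \<bullet> v\<close> makes \<open>v\<close> a singular vector for \<open>M\<close>.
\<close>
lemma exists_singular_value_bound:
  fixes A :: "real ^ 'n ^ 'm"
  shows "\<exists>M. singular_value A M \<and> (\<forall>y. norm (A *v y) \<le> M * norm y)"
proof -
  obtain v0 :: "real ^ 'n" where v0: "norm v0 = 1" using vector_choose_size[of 1] by auto
  have "continuous_on (sphere 0 1) (\<lambda>y. norm (A *v y))"
    by (intro continuous_intros linear_continuous_on matrix_vector_mul_bounded_linear)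
  moreover have "sphere (0 :: real ^ 'n) 1 \<noteq> {}" using v0 by auto
  ultimately obtain v where v: "norm v = 1" and
    vmax: "\<And>y. norm y = 1 \<Longrightarrow> norm (A *v y) \<le> norm (A *v v)"
    using continuous_attains_sup[of "sphere 0 1" "\<lambda>y. norm (A *v y)"] by auto
  define M where "M = norm (A *v v)"
  have M0: "0 \<le> M" by (simp add: M_def)
  have bound: "norm (A *v y) \<le> M * norm y" for y
  proof (cases "y = 0")
    case False
    have "norm (A *v (inverse (norm y) *\<^sub>R y)) \<le> M"
      unfolding M_def using False by (intro vmax) simp
    then show ?thesis
      using False by (simp add: matrix_vector_mult_scaleR field_simps)
  qed simp
  have tbound: "norm (transpose A *v u) \<le> M * norm u" for u
  proof (cases "transpose A *v u = 0")
    case False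
    let ?w = "transpose A *v u"
    have "(norm ?w)\<^sup>2 = u \<bullet> (A *v ?w)" by (simp only: power2_norm_eq_inner inner_transpose)
    also have "\<dots> \<le> norm u * norm (A *v ?w)" by (rule norm_cauchy_schwarz)
    also have "\<dots> \<le> norm u * (M * norm ?w)" by (intro mult_left_mono bound) simp
    finally show ?thesis using False by (simp add: power2_eq_square algebra_simps)
  qed (simp add: M0)
  have "singular_value A M"
  proof (cases "M = 0")
    case True
    obtain u0 :: "real ^ 'm" where u0: "norm u0 = 1" using vector_choose_size[of 1] by auto
    have "A *v v0 = 0" "transpose A *v u0 = 0"
      using bound[of v0] tbound[of u0] True by simp_all
    then show ?thesis using u0 v0 True by (auto simp: singular_value_def)
  next
    case False
    let ?w = "transpose A *v (A *v v)"
    have wv: "?w \<bullet> v = M\<^sup>2" by (simp only: inner_transpose M_def power2_norm_eq_inner)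
    have "norm ?w \<le> M * M" using tbound[of "A *v v"] by (simp add: M_def)
    then have nw: "(norm ?w)\<^sup>2 \<le> (M\<^sup>2)\<^sup>2"
      by (intro power_mono) (simp_all add: power2_eq_square)
    have "(norm (?w - M\<^sup>2 *\<^sub>R v))\<^sup>2 = (norm ?w)\<^sup>2 - 2 * M\<^sup>2 * (?w \<bullet> v) + (M\<^sup>2)\<^sup>2 * (norm v)\<^sup>2"
      unfolding power2_norm_eq_inner
      by (simp add: inner_diff_left inner_diff_right inner_commute power2_eq_square algebra_simps)
    also have "\<dots> \<le> 0" using nw wv v by (simp add: power2_eq_square)
    finally have w: "?w = M\<^sup>2 *\<^sub>R v" by simp
    show ?thesis unfolding singular_value_def
    proof (intro conjI exI[of _ "inverse M *\<^sub>R (A *v v)"] exI[of _ v] M0 v)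
      show "norm (inverse M *\<^sub>R (A *v v)) = 1" using False M0 by (simp flip: M_def)
      show "A *v v = M *\<^sub>R inverse M *\<^sub>R (A *v v)" using False by simp
      show "transpose A *v (inverse M *\<^sub>R (A *v v)) = M *\<^sub>R v"
        using False by (simp only: matrix_vector_mult_scaleR w) (simp add: power2_eq_square)
    qed
  qed
  then show ?thesis using bound by blast
qed

lemma norm_le_sigma_max:
  fixes A :: "real ^ 'n ^ 'm"
  shows "norm (A *v y) \<le> sigma_max A * norm y"
proof -
  obtain M where M: "singular_value A M" "\<And>y. norm (A *v y) \<le> M * norm y"
    using exists_singular_value_bound by blast
  have "M \<le> sigma_max A"
    unfolding sigma_max_def using M(1) by (intro Max_ge finite_singular_values) simp
  then have "M * norm y \<le> sigma_max A * norm y" by (intro mult_right_mono) simp_all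
  with M(2)[of y] show ?thesis by simp
qed

lemma sigma_max_nonneg: "0 \<le> sigma_max (A :: real ^ 'n ^ 'm)"
proof -
  obtain v :: "real ^ 'n" where "norm v = 1" using vector_choose_size[of 1] by auto
  then show ?thesis
    using order_trans[OF norm_ge_zero norm_le_sigma_max[of A v]] by simp
qed

lemma sum_rows_le_sigma_max:
  fixes A :: "real ^ 'n ^ 'm"
  shows "(\<Sum>i\<in>I. (row i A \<bullet> y)\<^sup>2) \<le> (sigma_max A * norm y)\<^sup>2"
proof -
  have "(\<Sum>i\<in>I. (row i A \<bullet> y)\<^sup>2) \<le> (norm (A *v y))\<^sup>2"
    unfolding norm_matrix_vector_square by (intro sum_mono2) auto
  also have "\<dots> \<le> (sigma_max A * norm y)\<^sup>2" by (intro power_mono norm_le_sigma_max) simp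
  finally show ?thesis .
qed

lemma sigma_max_pos:
  fixes A :: "real ^ 'n ^ 'm"
  assumes "\<And>i. norm (row i A) = 1"
  shows "0 < sigma_max A"
proof -
  fix i :: 'm
  have "row i A \<bullet> row i A = 1" using assms by (simp flip: power2_norm_eq_inner)
  then have "1 \<le> (sigma_max A)\<^sup>2"
    using sum_rows_le_sigma_max[where I = "{i}" and y = "row i A" and A = A] assms by simp
  then show ?thesis using sigma_max_nonneg[of A] by (cases "sigma_max A = 0") auto
qed

lemma sigma_sub_min_le:
  fixes A :: "real ^ 'n ^ 'm"
  assumes "real (card S) = \<alpha> * real CARD('m)"
  shows "(sigma_sub_min \<alpha> A)\<^sup>2 * (norm y)\<^sup>2 \<le> (\<Sum>i\<in>S. (row i A \<bullet> y)\<^sup>2)"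
proof (cases "y = 0")
  case False
  define F where "F = (\<lambda>S :: 'm set. INF y\<in>{y. y \<noteq> 0}. norm_sub_rows A S y / norm y)"
  define T where "T = {S :: 'm set. real (card S) = \<alpha> * real CARD('m)}"
  have S: "S \<in> T" using assms by (simp add: T_def)
  have sig: "sigma_sub_min \<alpha> A = Min (F ` T)" by (simp add: sigma_sub_min_def F_def T_def)
  have nonneg: "0 \<le> norm_sub_rows A S y / norm y" for S y by (simp add: norm_sub_rows_def)
  have F0: "0 \<le> F S" for S
    unfolding F_def using False by (intro cINF_greatest nonneg) auto
  have "Min (F ` T) \<in> F ` T" using S by (intro Min_in) auto
  then have s0: "0 \<le> sigma_sub_min \<alpha> A" unfolding sig using F0 by auto
  have "sigma_sub_min \<alpha> A \<le> F S" unfolding sig using S by (intro Min_le) auto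
  also have "F S \<le> norm_sub_rows A S y / norm y"
    unfolding F_def using False nonneg by (intro cINF_lower bdd_belowI2[of _ 0]) auto
  finally have "sigma_sub_min \<alpha> A * norm y \<le> norm_sub_rows A S y"
    using False by (simp add: field_simps)
  then have "(sigma_sub_min \<alpha> A * norm y)\<^sup>2 \<le> (norm_sub_rows A S y)\<^sup>2"
    using s0 by (intro power_mono) auto
  then show ?thesis
    by (simp add: power_mult_distrib norm_sub_rows_def L2_set_def sum_nonneg
        matrix_vector_component_row)
qed (simp add: sum_nonneg)

section \<open>Gain and loss in one step\<close>

lemma card_Diff_ge: "finite C \<Longrightarrow> real (card N) - real (card C) \<le> real (card (N - C))"
  using diff_card_le_card_Diff[of C N] by linarith

lemma norm_kaczmarz_step:
  fixes A :: "real ^ 'n ^ 'm"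
  assumes "norm (row i A) = 1"
  shows "(norm (kaczmarz_step A b y i - x))\<^sup>2 =
    (norm (y - x))\<^sup>2 + 2 * (b $ i - row i A \<bullet> y) * (row i A \<bullet> (y - x)) + (b $ i - row i A \<bullet> y)\<^sup>2"
proof -
  have a: "row i A \<bullet> row i A = 1" using assms by (simp flip: power2_norm_eq_inner)
  define e d where "e = y - x" and "d = b $ i - row i A \<bullet> y"
  have "kaczmarz_step A b y i - x = e + d *\<^sub>R row i A"
    by (simp add: kaczmarz_step_def e_def d_def)
  then have "(norm (kaczmarz_step A b y i - x))\<^sup>2
      = (norm e)\<^sup>2 + 2 * d * (row i A \<bullet> e) + d\<^sup>2 * (row i A \<bullet> row i A)"
    unfolding power2_norm_eq_inner
    by (simp add: inner_add_left inner_add_right inner_commute power2_eq_square algebra_simps)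
  then show ?thesis by (simp add: a e_def d_def)
qed

text \<open>
  Here \<open>B\<close> stands for the corrupted admissible rows and \<open>U\<close> for the uncorrupted rows whose residual
  reaches \<open>Q\<close>: the rows of \<open>U\<close> force \<open>Q\<close> to be of order \<open>\<parallel>A e\<parallel> / sqrt m\<close>.
\<close>
lemma corrupted_loss_bound:
  fixes A :: "real ^ 'n ^ 'm" and Q :: real
  assumes "0 \<le> \<beta>" and "q < 1 - \<beta>" and "0 \<le> Q"
    and B: "real (card B) \<le> \<beta> * real CARD('m)"
    and U: "(1 - q - \<beta>) * real CARD('m) \<le> real (card U)"
    and QU: "\<And>i. i \<in> U \<Longrightarrow> Q \<le> \<bar>row i A \<bullet> e\<bar>"
  shows "(\<Sum>i\<in>B. 2 * Q * \<bar>row i A \<bullet> e\<bar> + Q\<^sup>2)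
    \<le> (sigma_max A)\<^sup>2 * corruption_factor \<beta> q * (norm e)\<^sup>2"
proof -
  define m where "m = real CARD('m)"
  define \<gamma> where "\<gamma> = 1 - q - \<beta>"
  define t where "t = sigma_max A * norm e"
  have m: "0 < m" by (simp add: m_def)
  have g: "0 < \<gamma>" using assms by (simp add: \<gamma>_def)
  have t0: "0 \<le> t" by (simp add: t_def sigma_max_nonneg)
  have "\<gamma> * m * Q\<^sup>2 \<le> real (card U) * Q\<^sup>2"
    using U by (intro mult_right_mono) (simp_all add: \<gamma>_def m_def)
  also have "\<dots> = (\<Sum>i\<in>U. Q\<^sup>2)" by simp
  also have "\<dots> \<le> (\<Sum>i\<in>U. (row i A \<bullet> e)\<^sup>2)"
  proof (intro sum_mono)
    fix i assume "i \<in> U"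
    then have "Q\<^sup>2 \<le> \<bar>row i A \<bullet> e\<bar>\<^sup>2" using QU \<open>0 \<le> Q\<close> by (intro power_mono)
    then show "Q\<^sup>2 \<le> (row i A \<bullet> e)\<^sup>2" by simp
  qed
  also have "\<dots> \<le> t\<^sup>2" unfolding t_def by (rule sum_rows_le_sigma_max)
  finally have Q2: "m * Q\<^sup>2 \<le> t\<^sup>2 / \<gamma>" using g by (simp add: field_simps)
  then have "sqrt (m * Q\<^sup>2) \<le> sqrt (t\<^sup>2 / \<gamma>)" by (rule real_sqrt_le_mono)
  then have Q1: "sqrt m * Q \<le> t / sqrt \<gamma>"
    using \<open>0 \<le> Q\<close> t0 by (simp add: real_sqrt_mult real_sqrt_divide)
  have "(\<Sum>i\<in>B. \<bar>row i A \<bullet> e\<bar>) \<le> L2_set (\<lambda>i. 1) B * L2_set (\<lambda>i. row i A \<bullet> e) B"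
    using L2_set_mult_ineq[of "\<lambda>i. 1" "\<lambda>i. row i A \<bullet> e" B] by simp
  also have "\<dots> \<le> sqrt (\<beta> * m) * t"
  proof (intro mult_mono)
    show "L2_set (\<lambda>i. 1) B \<le> sqrt (\<beta> * m)" using B by (simp add: L2_set_def m_def)
    have "L2_set (\<lambda>i. row i A \<bullet> e) B \<le> sqrt (t\<^sup>2)"
      unfolding L2_set_def t_def by (intro real_sqrt_le_mono sum_rows_le_sigma_max)
    then show "L2_set (\<lambda>i. row i A \<bullet> e) B \<le> t" using t0 by simp
  qed (use m \<open>0 \<le> \<beta>\<close> in auto)
  finally have R: "(\<Sum>i\<in>B. \<bar>row i A \<bullet> e\<bar>) \<le> sqrt (\<beta> * m) * t" .
  have "(\<Sum>i\<in>B. 2 * Q * \<bar>row i A \<bullet> e\<bar> + Q\<^sup>2)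
      = 2 * Q * (\<Sum>i\<in>B. \<bar>row i A \<bullet> e\<bar>) + real (card B) * Q\<^sup>2"
    by (simp add: sum.distrib sum_distrib_left)
  also have "\<dots> \<le> 2 * Q * (sqrt (\<beta> * m) * t) + \<beta> * m * Q\<^sup>2"
    using B R \<open>0 \<le> Q\<close> by (intro add_mono mult_left_mono mult_right_mono) (simp_all add: m_def)
  also have "\<dots> = 2 * sqrt \<beta> * t * (sqrt m * Q) + \<beta> * (m * Q\<^sup>2)"
    by (simp add: real_sqrt_mult)
  also have "\<dots> \<le> 2 * sqrt \<beta> * t * (t / sqrt \<gamma>) + \<beta> * (t\<^sup>2 / \<gamma>)"
    using Q1 Q2 t0 \<open>0 \<le> \<beta>\<close> by (intro add_mono mult_left_mono) simp_all
  also have "\<dots> = (sigma_max A)\<^sup>2 * corruption_factor \<beta> q * (norm e)\<^sup>2"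
    by (simp add: corruption_factor_def t_def \<gamma>_def power2_eq_square algebra_simps)
  finally show ?thesis .
qed

lemma average_gain_bound:
  fixes A :: "real ^ 'n ^ 'm"
  assumes "0 \<le> \<beta>" and "\<beta> < q"
    and int: "q * real CARD('m) \<in> \<int>" "\<beta> * real CARD('m) \<in> \<int>"
    and N: "q * real CARD('m) \<le> real (card N)"
    and C: "real (card C) \<le> \<beta> * real CARD('m)"
  shows "real (card N) * ((sigma_sub_min (q - \<beta>) A)\<^sup>2 / (q * real CARD('m)) * (norm e)\<^sup>2)
    \<le> (\<Sum>i\<in>N - C. (row i A \<bullet> e)\<^sup>2)"
proof -
  define m where "m = real CARD('m)"
  define G where "G = N - C"
  define s where "s = real (card N)"
  define g where "g = (sigma_sub_min (q - \<beta>) A)\<^sup>2 * (norm e)\<^sup>2"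
  have m: "0 < m" by (simp add: m_def)
  have g0: "0 \<le> g" by (simp add: g_def)
  have pos: "0 < (q - \<beta>) * m" "0 < q * m" using assms m by simp_all
  have "(q - \<beta>) * m \<in> \<int>" using int by (simp add: m_def left_diff_distrib)
  then obtain k :: nat where k: "real k = (q - \<beta>) * m"
    using pos(1) by (metis Ints_cases less_imp_le of_int_0_le_iff of_int_of_nat_eq zero_le_imp_eq_int)
  have cG: "s - \<beta> * m \<le> real (card G)"
    using card_Diff_ge[of C N] C by (simp add: G_def s_def m_def)
  then have "real k \<le> real (card G)" using N by (simp add: k s_def m_def algebra_simps)
  then obtain S where S: "S \<subseteq> G" "card S = k"
    "real (card G) * (\<Sum>i\<in>S. (row i A \<bullet> e)\<^sup>2) \<le> real k * (\<Sum>i\<in>G. (row i A \<bullet> e)\<^sup>2)"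
    using exists_subset_below_average[of G k "\<lambda>i. (row i A \<bullet> e)\<^sup>2"] by auto
  have low: "g \<le> (\<Sum>i\<in>S. (row i A \<bullet> e)\<^sup>2)"
    unfolding g_def using S(2) k by (intro sigma_sub_min_le) (simp add: m_def)
  have "\<beta> * (q * m) \<le> \<beta> * s" using N \<open>0 \<le> \<beta>\<close> by (intro mult_left_mono) (simp_all add: s_def m_def)
  then have "s * (q - \<beta>) \<le> q * (s - \<beta> * m)" by (simp add: algebra_simps)
  also have "\<dots> \<le> q * real (card G)" using cG assms by (intro mult_left_mono) simp_all
  finally have "m * (s * (q - \<beta>)) * g \<le> m * (q * real (card G)) * g"
    using m g0 by (intro mult_right_mono mult_left_mono) simp_all
  also have "\<dots> = q * m * (real (card G) * g)" by simp
  also have "\<dots> \<le> q * m * (real (card G) * (\<Sum>i\<in>S. (row i A \<bullet> e)\<^sup>2))"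
    using low pos by (intro mult_left_mono) simp_all
  also have "\<dots> \<le> q * m * (real k * (\<Sum>i\<in>G. (row i A \<bullet> e)\<^sup>2))"
    using S(3) pos by (intro mult_left_mono) simp_all
  finally have "((q - \<beta>) * m) * (s * g) \<le> ((q - \<beta>) * m) * (q * m * (\<Sum>i\<in>G. (row i A \<bullet> e)\<^sup>2))"
    by (simp add: k algebra_simps)
  then have "s * g \<le> q * m * (\<Sum>i\<in>G. (row i A \<bullet> e)\<^sup>2)"
    using pos(1) by (simp only: mult_le_cancel_left_pos)
  then show ?thesis
    using pos(2) by (simp add: s_def g_def G_def flip: m_def) (simp add: field_simps)
qed

lemma admissible_rows_nonempty:
  fixes A :: "real ^ 'n ^ 'm"
  assumes "0 < q" "q < 1" "q * real CARD('m) \<in> \<int>"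
  shows "admissible_rows q A b y \<noteq> {}"
proof -
  have "0 < q * real CARD('m)" using assms by simp
  also have "\<dots> \<le> real (card (admissible_rows q A b y))"
    unfolding admissible_rows_def by (rule quantile_counts(1)[OF assms])
  finally show ?thesis by auto
qed

text \<open>
  The gain estimate is better than the one in \<open>rate\<close> by the factor \<open>q / (q - \<beta>) \<ge> 1\<close>.
\<close>
lemma one_step_contraction:
  fixes A :: "real ^ 'n ^ 'm"
  assumes rows: "\<And>i. norm (row i A) = 1"
    and par: "0 \<le> \<beta>" "0 < q" "q < 1" "\<beta> < q" "q < 1 - \<beta>"
    and int: "q * real CARD('m) \<in> \<int>" "\<beta> * real CARD('m) \<in> \<int>"
    and l0: "real (l0_norm (b - A *v x)) \<le> \<beta> * real CARD('m)"
  shows "measure_pmf.expectation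
      (map_pmf (kaczmarz_step A b y) (pmf_of_set (admissible_rows q A b y))) (\<lambda>z. (norm (z - x))\<^sup>2)
    \<le> (1 - rate A \<beta> q) * (norm (y - x))\<^sup>2"
proof -
  define m where "m = real CARD('m)"
  define e where "e = y - x"
  define r where "r = (\<lambda>i. row i A \<bullet> e)"
  define N where "N = admissible_rows q A b y"
  define s where "s = real (card N)"
  define C where "C = {i. (b - A *v x) $ i \<noteq> 0}"
  define Q where "Q = quantile q (residual A b y)"
  define g where "g = (sigma_sub_min (q - \<beta>) A)\<^sup>2 / (q * m)"
  define l where "l = (sigma_max A)\<^sup>2 * corruption_factor \<beta> q"
  have m: "0 < m" by (simp add: m_def)
  have g0: "0 \<le> g" using par m by (simp add: g_def)
  have l0': "0 \<le> l" using par by (simp add: l_def corruption_factor_def)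
  have cC: "real (card C) \<le> \<beta> * m" using l0 by (simp add: C_def l0_norm_def m_def)
  have Ne: "N \<noteq> {}" unfolding N_def by (rule admissible_rows_nonempty[OF par(2,3) int(1)])
  have cN: "q * m \<le> s"
    using quantile_counts(1)[OF par(2,3) int(1), of "residual A b y"]
    by (simp add: N_def admissible_rows_def m_def s_def)
  have s: "0 < s" using Ne by (simp add: s_def card_gt_0_iff)
  have N_le: "\<bar>b $ i - row i A \<bullet> y\<bar> \<le> Q" if "i \<in> N" for i
    using that by (simp add: N_def admissible_rows_def Q_def residual_def inner_commute abs_minus_commute)
  have Q0: "0 \<le> Q" using Ne N_le by (meson abs_ge_zero all_not_in_conv order_trans)
  have uncorrupted: "b $ i - row i A \<bullet> y = - r i" if "i \<notin> C" for i
    using that by (simp add: C_def r_def e_def matrix_vector_component_row inner_diff_right)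
  define U where "U = {i. Q \<le> residual A b y i} - C"
  have "(1 - q) * m \<le> real (card {i. Q \<le> residual A b y i})"
    unfolding Q_def m_def by (rule quantile_counts(2)[OF par(2,3) int(1)])
  then have cU: "(1 - q - \<beta>) * m \<le> real (card U)"
    using card_Diff_ge[of C "{i. Q \<le> residual A b y i}"] cC by (simp add: U_def algebra_simps)
  have QU: "Q \<le> \<bar>row i A \<bullet> e\<bar>" if "i \<in> U" for i
    using that uncorrupted[of i]
    by (auto simp: U_def residual_def r_def inner_commute abs_minus_commute)
  have "card (N \<inter> C) \<le> card C" by (intro card_mono) auto
  then have cB: "real (card (N \<inter> C)) \<le> \<beta> * real CARD('m)" using cC by (simp add: m_def)
  have loss: "(\<Sum>i\<in>N \<inter> C. 2 * Q * \<bar>r i\<bar> + Q\<^sup>2) \<le> l * (norm e)\<^sup>2"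
    unfolding r_def l_def
    using corrupted_loss_bound[OF par(1,5) Q0 cB cU[unfolded m_def] QU] .
  have gain: "s * (g * (norm e)\<^sup>2) \<le> (\<Sum>i\<in>N - C. (r i)\<^sup>2)"
    using average_gain_bound[OF par(1,4) int cN[unfolded m_def s_def] cC[unfolded m_def]]
    by (simp add: s_def g_def r_def m_def)
  have good: "(norm (kaczmarz_step A b y i - x))\<^sup>2 = (norm e)\<^sup>2 - (r i)\<^sup>2" if "i \<in> N - C" for i
    using uncorrupted[of i] that norm_kaczmarz_step[OF rows, of b y i x]
    by (simp add: r_def e_def power2_eq_square)
  have bad: "(norm (kaczmarz_step A b y i - x))\<^sup>2 \<le> (norm e)\<^sup>2 + (2 * Q * \<bar>r i\<bar> + Q\<^sup>2)"
    if "i \<in> N \<inter> C" for i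
  proof -
    define d where "d = b $ i - row i A \<bullet> y"
    have d: "\<bar>d\<bar> \<le> Q" using N_le that by (simp add: d_def)
    have "d * r i \<le> \<bar>d\<bar> * \<bar>r i\<bar>" by (simp flip: abs_mult)
    also have "\<dots> \<le> Q * \<bar>r i\<bar>" using d by (intro mult_right_mono) simp_all
    finally have "2 * d * r i \<le> 2 * Q * \<bar>r i\<bar>" by simp
    moreover have "d\<^sup>2 \<le> Q\<^sup>2" using d Q0 by (simp add: abs_le_square_iff[symmetric])
    ultimately show ?thesis
      using norm_kaczmarz_step[OF rows, of b y i x] by (simp add: d_def r_def e_def)
  qed
  have "(\<Sum>i\<in>N. (norm (kaczmarz_step A b y i - x))\<^sup>2)
      = (\<Sum>i\<in>N \<inter> C. (norm (kaczmarz_step A b y i - x))\<^sup>2)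
        + (\<Sum>i\<in>N - C. (norm (kaczmarz_step A b y i - x))\<^sup>2)"
    by (rule sum.Int_Diff) simp
  also have "\<dots> \<le> (\<Sum>i\<in>N \<inter> C. (norm e)\<^sup>2 + (2 * Q * \<bar>r i\<bar> + Q\<^sup>2))
        + (\<Sum>i\<in>N - C. (norm e)\<^sup>2 - (r i)\<^sup>2)"
    using good by (intro add_mono sum_mono bad) simp_all
  also have "\<dots> = (\<Sum>i\<in>N. (norm e)\<^sup>2) + (\<Sum>i\<in>N \<inter> C. 2 * Q * \<bar>r i\<bar> + Q\<^sup>2) - (\<Sum>i\<in>N - C. (r i)\<^sup>2)"
    by (simp only: sum.distrib sum_subtractf sum.Int_Diff[of N "\<lambda>_. (norm e)\<^sup>2" C, OF finite])
  also have "\<dots> \<le> s * (norm e)\<^sup>2 + l * (norm e)\<^sup>2 - s * (g * (norm e)\<^sup>2)"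
    using loss gain by (simp add: s_def)
  finally have total: "(\<Sum>i\<in>N. (norm (kaczmarz_step A b y i - x))\<^sup>2) / s
      \<le> (1 - (g - l / s)) * (norm e)\<^sup>2"
    using s by (simp add: field_simps)
  have "l / s \<le> l / (q * m)" using cN l0' s par(2) m by (intro divide_left_mono) simp_all
  moreover have "(q - \<beta>) / q * g \<le> 1 * g"
    using par g0 by (intro mult_right_mono) simp_all
  moreover have "rate A \<beta> q = (q - \<beta>) / q * g - l / (q * m)"
    by (simp add: rate_def g_def l_def m_def power2_eq_square)
  ultimately have "rate A \<beta> q \<le> g - l / s" by simp
  then have "(1 - (g - l / s)) * (norm e)\<^sup>2 \<le> (1 - rate A \<beta> q) * (norm e)\<^sup>2"
    by (intro mult_right_mono) simp_all
  with total show ?thesis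
    using Ne by (simp add: integral_pmf_of_set s_def e_def flip: N_def)
qed

section \<open>Convergence\<close>

lemma finite_set_pmf_quantile_kaczmarz:
  fixes A :: "real ^ 'n ^ 'm"
  assumes "0 < q" "q < 1" "q * real CARD('m) \<in> \<int>"
  shows "finite (set_pmf (quantile_kaczmarz q A b x0 k))"
  by (induction k) (auto simp: admissible_rows_nonempty[OF assms])

lemma rate_pos:
  fixes A :: "real ^ 'n ^ 'm"
  assumes "0 < sigma_max A" "0 < q" "\<beta> < q"
    and "q / (q - \<beta>) * corruption_factor \<beta> q < (sigma_sub_min (q - \<beta>) A)\<^sup>2 / (sigma_max A)\<^sup>2"
  shows "0 < rate A \<beta> q"
proof -
  define m where "m = real CARD('m)"
  have m: "0 < m" by (simp add: m_def)
  have "(sigma_max A)\<^sup>2 * (q * corruption_factor \<beta> q) < (q - \<beta>) * (sigma_sub_min (q - \<beta>) A)\<^sup>2"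
    using assms by (simp add: field_simps)
  then have "0 < ((q - \<beta>) * (sigma_sub_min (q - \<beta>) A)\<^sup>2
      - (sigma_max A)\<^sup>2 * (q * corruption_factor \<beta> q)) / (q\<^sup>2 * m)"
    using m assms by simp
  also have "\<dots> = rate A \<beta> q"
    using m assms by (simp add: rate_def power2_eq_square field_simps flip: m_def)
  finally show ?thesis .
qed

theorem mainTheorem1:
  fixes A :: "real ^ 'n ^ 'm" and x :: "real ^ 'n" and b\<^sub>t :: "real ^ 'm" and \<beta> q :: real
  assumes "\<And>i. norm (row i A) = 1"
    and "b\<^sub>t = A *v x"
    and "0 \<le> \<beta>" and "0 < q" and "q < 1"
    and "\<beta> < q" and "q < 1 - \<beta>"
    and "q * real CARD('m) \<in> \<int>" and "\<beta> * real CARD('m) \<in> \<int>"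
    and "q / (q - \<beta>) * corruption_factor \<beta> q
           < (sigma_sub_min (q - \<beta>) A)\<^sup>2 / (sigma_max A)\<^sup>2"
  shows "rate A \<beta> q > 0 \<and>
    (\<forall>(b :: real ^ 'm) (x0 :: real ^ 'n) (k :: nat).
       real (l0_norm (b - b\<^sub>t)) \<le> \<beta> * real CARD('m) \<longrightarrow>
       measure_pmf.expectation (quantile_kaczmarz q A b x0 k) (\<lambda>y. (norm (y - x))\<^sup>2)
         \<le> (1 - rate A \<beta> q) ^ k * (norm (x0 - x))\<^sup>2)"
proof (intro conjI allI impI)
  show "rate A \<beta> q > 0" by (rule rate_pos[OF sigma_max_pos]) (use assms in auto)
next
  fix b :: "real ^ 'm" and x0 :: "real ^ 'n" and k :: nat
  assume l0: "real (l0_norm (b - b\<^sub>t)) \<le> \<beta> * real CARD('m)"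
  let ?h = "\<lambda>y. (norm (y - x))\<^sup>2" and ?c = "1 - rate A \<beta> q"
  let ?K = "\<lambda>y. map_pmf (kaczmarz_step A b y) (pmf_of_set (admissible_rows q A b y))"
  have step: "measure_pmf.expectation (?K y) ?h \<le> ?c * ?h y" for y
    by (rule one_step_contraction) (use assms l0 in auto)
  have c0: "0 \<le> ?c"
  proof -
    obtain v :: "real ^ 'n" where v: "norm v = 1" using vector_choose_size[of 1] by auto
    have "0 \<le> measure_pmf.expectation (?K (x + v)) ?h"
      by (rule Bochner_Integration.integral_nonneg) simp
    also have "\<dots> \<le> ?c * ?h (x + v)" by (rule step)
    finally show ?thesis using v by simp
  qed
  show "measure_pmf.expectation (quantile_kaczmarz q A b x0 k) ?h \<le> ?c ^ k * (norm (x0 - x))\<^sup>2"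
  proof (induction k)
    case (Suc k)
    let ?p = "quantile_kaczmarz q A b x0 k"
    have fin: "finite (set_pmf ?p)"
      by (rule finite_set_pmf_quantile_kaczmarz) (use assms in auto)
    have finK: "finite (set_pmf (?K y))" for y
      using admissible_rows_nonempty[of q A b y] assms by simp
    have "measure_pmf.expectation (quantile_kaczmarz q A b x0 (Suc k)) ?h
        = (\<Sum>y\<in>set_pmf ?p. pmf ?p y *\<^sub>R measure_pmf.expectation (?K y) ?h)"
      unfolding quantile_kaczmarz.simps using fin finK by (intro pmf_expectation_bind) auto
    also have "\<dots> \<le> (\<Sum>y\<in>set_pmf ?p. pmf ?p y *\<^sub>R (?c * ?h y))"
      by (intro sum_mono scaleR_left_mono step) simp
    also have "\<dots> = ?c * measure_pmf.expectation ?p ?h"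
      using fin by (subst integral_measure_pmf[of "set_pmf ?p"])
        (auto simp: sum_distrib_left algebra_simps)
    also have "\<dots> \<le> ?c * (?c ^ k * (norm (x0 - x))\<^sup>2)"
      by (intro mult_left_mono Suc.IH c0)
    finally show ?case by simp
  qed simp
qed

end
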